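(* Let $[X,\mathcal{B},m,\nu]$ be a reversible random walk space and let $\Omega\in\mathcal{B}$ be $m$-connected with $0<\nu(\Omega)<\nu(\Omega_m)<\infty$, and assume $\Omega$ satisfies a $2$-Poincaré inequality. Then $$T_m(\Omega)=\max\left\{\frac{\left(\int_\Omega g\,d\nu\right)^2}{\frac12\int_{\Omega_m}\int_{\Omega_m}|\nabla g(x,y)|^2\,dm_x(y)\,d\nu(x)}\;:\; g\in L^2(\Omega_m,\nu)\setminus\{0\},\ g=0 \text{ on } \partial_m\Omega\right\},$$ and the maximum is attained at the $m$-stress function $f_\Omega$.
   Context: A random walk $m$ on a measurable space $(X,\mathcal{B})$ ($\mathcal{B}$ countably generated) is a family $(m_x)_{x\in X}$ of probability measures on $\mathcal{B}$ such that $x\mapsto m_x(B)$ is measurable for each $B\in\mathcal{B}$. A $\sigma$-finite measure $\nu$ on $X$ is reversible if $dm_x(y)d\nu(x)=dm_y(x)d\nu(y)$ as measures on $X\times X$; then $[X,\mathcal{B},m,\nu]$ is called a reversible random walk space. For $A,B\in\mathcal{B}$, $L_m(A,B):=\int_A m_x(B)\,d\nu(x)$. For $\Omega\in\mathcal{B}$: $\partial_m\Omega:=\{x\in X\setminus\Omega: m_x(\Omega)>0\}$ and $\Omega_m:=\Omega\cup\partial_m\Omega$. A set $\Omega\in\mathcal B$ with $\nu(\Omega)>0$ is $m$-connected if $L_m(A,B)>0$ for all measurable $A,B\subset\Omega$ of positive $\nu$-measure with $A\cup B=\Omega$. For a function $f$, $\nabla f(x,y):=f(y)-f(x)$. $\Omega$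 satisfies a $2$-Poincaré inequality if there is $\lambda>0$ with $\lambda\int_\Omega|f|^2d\nu\le\int_{\Omega_m}\int_{\Omega_m}|\nabla f(x,y)|^2dm_x(y)d\nu(x)$ for all $f\in L^2(\Omega_m,\nu)$ with $f=0$ $\nu$-a.e. on $\partial_m\Omega$. The $m$-stress function $f_\Omega$ of $\Omega$ is the unique solution in $L^2(\Omega_m,\nu)$ (equalities $\nu$-a.e.) of $$-\int_{\Omega_m}(f_\Omega(y)-f_\Omega(x))\,dm_x(y)=1\ \ (x\in\Omega),\qquad f_\Omega(x)=0\ \ (x\in\partial_m\Omega).$$ It is nonnegative. The $m$-torsional rigidity of $\Omega$ is $T_m(\Omega):=\int_\Omega f_\Omega\,d\nu$. *)

theory Defs
  imports "HOL-Probability.Probability"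
begin

text \<open>
  The measure \<open>\<nu>\<close> carries the measurable space: \<open>X = space \<nu>\<close> and \<open>\<B> = sets \<nu>\<close>.
\<close>

definition countably_generated :: "'a measure \<Rightarrow> bool" where
  "countably_generated M \<longleftrightarrow>
     (\<exists>G. countable G \<and> G \<subseteq> Pow (space M) \<and> sets M = sigma_sets (space M) G)"

definition random_walk :: "'a measure \<Rightarrow> ('a \<Rightarrow> 'a measure) \<Rightarrow> bool" where
  "random_walk M m \<longleftrightarrow> countably_generated M \<and>
     (\<forall>x\<in>space M. prob_space (m x) \<and> sets (m x) = sets M) \<and>
     (\<forall>B\<in>sets M. (\<lambda>x. emeasure (m x) B) \<in> borel_measurable M)"

text \<open>
  Equality of the measures \<open>dm\<^sub>x(y) d\<nu>(x)\<close> and \<open>dm\<^sub>y(x) d\<nu>(y)\<close> on \<open>X \<times> X\<close>,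
  tested on every set of the product \<open>\<sigma>\<close>-algebra.
\<close>
definition reversible :: "('a \<Rightarrow> 'a measure) \<Rightarrow> 'a measure \<Rightarrow> bool" where
  "reversible m \<nu> \<longleftrightarrow> (\<forall>C\<in>sets (\<nu> \<Otimes>\<^sub>M \<nu>).
     (\<integral>\<^sup>+x. \<integral>\<^sup>+y. indicator C (x, y) \<partial>m x \<partial>\<nu>) =
     (\<integral>\<^sup>+y. \<integral>\<^sup>+x. indicator C (x, y) \<partial>m y \<partial>\<nu>))"

definition reversible_random_walk_space :: "('a \<Rightarrow> 'a measure) \<Rightarrow> 'a measure \<Rightarrow> bool" where
  "reversible_random_walk_space m \<nu> \<longleftrightarrow>
     random_walk \<nu> m \<and> sigma_finite_measure \<nu> \<and> reversible m \<nu>"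

definition m_interaction ::
    "('a \<Rightarrow> 'a measure) \<Rightarrow> 'a measure \<Rightarrow> 'a set \<Rightarrow> 'a set \<Rightarrow> ennreal" where
  "m_interaction m \<nu> A B = (\<integral>\<^sup>+x\<in>A. emeasure (m x) B \<partial>\<nu>)"

definition m_boundary :: "('a \<Rightarrow> 'a measure) \<Rightarrow> 'a measure \<Rightarrow> 'a set \<Rightarrow> 'a set" where
  "m_boundary m \<nu> \<Omega> = {x \<in> space \<nu> - \<Omega>. emeasure (m x) \<Omega> > 0}"

definition m_closure :: "('a \<Rightarrow> 'a measure) \<Rightarrow> 'a measure \<Rightarrow> 'a set \<Rightarrow> 'a set" where
  "m_closure m \<nu> \<Omega> = \<Omega> \<union> m_boundary m \<nu> \<Omega>"

definition m_connected :: "('a \<Rightarrow> 'a measure) \<Rightarrow> 'a measure \<Rightarrow> 'a set \<Rightarrow> bool" where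
  "m_connected m \<nu> \<Omega> \<longleftrightarrow> \<Omega> \<in> sets \<nu> \<and> emeasure \<nu> \<Omega> > 0 \<and>
     (\<forall>A\<in>sets \<nu>. \<forall>B\<in>sets \<nu>. A \<subseteq> \<Omega> \<longrightarrow> B \<subseteq> \<Omega> \<longrightarrow> A \<union> B = \<Omega> \<longrightarrow>
        emeasure \<nu> A > 0 \<longrightarrow> emeasure \<nu> B > 0 \<longrightarrow> m_interaction m \<nu> A B > 0)"

definition grad :: "('a \<Rightarrow> real) \<Rightarrow> 'a \<Rightarrow> 'a \<Rightarrow> real" where
  "grad f x y = f y - f x"

text \<open>
  Elements of \<open>L\<^sup>2(A, \<nu>)\<close> are represented by functions; values outside \<open>A\<close> are irrelevant, and
  equality in \<open>L\<^sup>2\<close> is equality \<open>\<nu>\<close>-almost everywhere on \<open>A\<close>.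
\<close>
definition L2 :: "'a measure \<Rightarrow> 'a set \<Rightarrow> ('a \<Rightarrow> real) set" where
  "L2 \<nu> A = {f \<in> borel_measurable (restrict_space \<nu> A).
               integrable (restrict_space \<nu> A) (\<lambda>x. (f x)\<^sup>2)}"

definition L2_vanishing ::
    "('a \<Rightarrow> 'a measure) \<Rightarrow> 'a measure \<Rightarrow> 'a set \<Rightarrow> ('a \<Rightarrow> real) set" where
  "L2_vanishing m \<nu> \<Omega> =
     {f \<in> L2 \<nu> (m_closure m \<nu> \<Omega>). AE x in \<nu>. x \<in> m_boundary m \<nu> \<Omega> \<longrightarrow> f x = 0}"

definition grad_integral ::
    "('a \<Rightarrow> 'a measure) \<Rightarrow> 'a measure \<Rightarrow> 'a set \<Rightarrow> ('a \<Rightarrow> real) \<Rightarrow> real" where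
  "grad_integral m \<nu> \<Omega> f =
     (LINT x:m_closure m \<nu> \<Omega>|\<nu>. (LINT y:m_closure m \<nu> \<Omega>|m x. \<bar>grad f x y\<bar>\<^sup>2))"

definition poincare2 :: "('a \<Rightarrow> 'a measure) \<Rightarrow> 'a measure \<Rightarrow> 'a set \<Rightarrow> bool" where
  "poincare2 m \<nu> \<Omega> \<longleftrightarrow> (\<exists>c>0. \<forall>f\<in>L2_vanishing m \<nu> \<Omega>.
     c * (LINT x:\<Omega>|\<nu>. \<bar>f x\<bar>\<^sup>2) \<le> grad_integral m \<nu> \<Omega> f)"

text \<open>
  No integrability has to be required below: the integral of a non-integrable function is \<open>0\<close>,
  hence different from \<open>-1\<close>.
\<close>
definition is_stress_function ::
    "('a \<Rightarrow> 'a measure) \<Rightarrow> 'a measure \<Rightarrow> 'a set \<Rightarrow> ('a \<Rightarrow> real) \<Rightarrow> bool" where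
  "is_stress_function m \<nu> \<Omega> f \<longleftrightarrow>
     f \<in> L2 \<nu> (m_closure m \<nu> \<Omega>) \<and>
     (AE x in \<nu>. x \<in> \<Omega> \<longrightarrow> - (LINT y:m_closure m \<nu> \<Omega>|m x. (f y - f x)) = 1) \<and>
     (AE x in \<nu>. x \<in> m_boundary m \<nu> \<Omega> \<longrightarrow> f x = 0)"

text \<open>
  The solution is unique only as an element of \<open>L\<^sup>2(\<Omega>\<^sub>m, \<nu>)\<close>, so a representative is chosen.
\<close>
definition stress_function ::
    "('a \<Rightarrow> 'a measure) \<Rightarrow> 'a measure \<Rightarrow> 'a set \<Rightarrow> 'a \<Rightarrow> real" where
  "stress_function m \<nu> \<Omega> = (SOME f. is_stress_function m \<nu> \<Omega> f)"

definition torsional_rigidity :: "('a \<Rightarrow> 'a measure) \<Rightarrow> 'a measure \<Rightarrow> 'a set \<Rightarrow> real" where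
  "torsional_rigidity m \<nu> \<Omega> = (LINT x:\<Omega>|\<nu>. stress_function m \<nu> \<Omega> x)"

definition torsion_admissible ::
    "('a \<Rightarrow> 'a measure) \<Rightarrow> 'a measure \<Rightarrow> 'a set \<Rightarrow> ('a \<Rightarrow> real) set" where
  "torsion_admissible m \<nu> \<Omega> =
     {g \<in> L2_vanishing m \<nu> \<Omega>. \<not> (AE x in \<nu>. x \<in> m_closure m \<nu> \<Omega> \<longrightarrow> g x = 0)}"

definition torsion_quotient ::
    "('a \<Rightarrow> 'a measure) \<Rightarrow> 'a measure \<Rightarrow> 'a set \<Rightarrow> ('a \<Rightarrow> real) \<Rightarrow> real" where
  "torsion_quotient m \<nu> \<Omega> g = (LINT x:\<Omega>|\<nu>. g x)\<^sup>2 / (1 / 2 * grad_integral m \<nu> \<Omega> g)"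

end

theory Submission
  imports Defs
begin

text \<open>
  On \<open>X \<times> X\<close> the measure \<open>\<kappa> = dm\<^sub>x(y) d\<nu>(x)\<close> is symmetric with both marginals \<open>\<nu>\<close>, and
  a.e. edge that meets \<open>\<Omega>\<close> stays in \<open>\<Omega>\<^sub>m\<close>. So functions vanishing on the boundary may be
  extended by \<open>0\<close>, and \<open>\<integral>\<integral> |\<nabla>g|\<^sup>2\<close> becomes the squared norm of the gradient in \<open>L\<^sup>2(\<kappa>)\<close>.
  Green's formula and the stress equation give \<open>\<integral> \<nabla>f \<cdot> \<nabla>g d\<kappa> = 2 \<integral> g d\<nu>\<close> for the stress function
  \<open>f\<close> and every admissible \<open>g\<close>; the Cauchy-Schwarz inequality in \<open>L\<^sup>2(\<kappa>)\<close> then bounds the quotient,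
  with equality at \<open>g = f\<close>.

  The stress function exists as the increasing limit of \<open>u\<^sub>0 = 0\<close>,
  \<open>u\<^sub>n\<^sub>+\<^sub>1 = 1 + \<integral> u\<^sub>n dm\<^sub>x\<close> on \<open>\<Omega>\<close>; the Poincare inequality bounds \<open>u\<^sub>n\<close> in \<open>L\<^sup>2\<close> uniformly in \<open>n\<close>.
\<close>

section \<open>Products of square-integrable functions\<close>

lemma integrable_mult_square_integrable:
  fixes f g :: "'a \<Rightarrow> real"
  assumes [measurable]: "f \<in> borel_measurable M" "g \<in> borel_measurable M"
    and "integrable M (\<lambda>x. (f x)\<^sup>2)" "integrable M (\<lambda>x. (g x)\<^sup>2)"
  shows "integrable M (\<lambda>x. f x * g x)"
proof (rule Bochner_Integration.integrable_bound)
  show "integrable M (\<lambda>x. (f x)\<^sup>2 + (g x)\<^sup>2)" using assms by simp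
  have "\<bar>f x * g x\<bar> \<le> (f x)\<^sup>2 + (g x)\<^sup>2" for x
    using sum_squares_bound[of "\<bar>f x\<bar>" "\<bar>g x\<bar>"] mult_nonneg_nonneg[of "\<bar>f x\<bar>" "\<bar>g x\<bar>"]
    unfolding abs_mult by (simp del: mult_nonneg_nonneg)
  then show "AE x in M. norm (f x * g x) \<le> norm ((f x)\<^sup>2 + (g x)\<^sup>2)" by simp
qed simp

text \<open>The integral of (f - t g)^2 is a nonnegative quadratic polynomial in t with coefficients
  \<open>A\<close>, \<open>B\<close>, \<open>C\<close>. Its value at the minimiser t = B / C is the
  inequality; the degenerate case C = 0 is treated apart.\<close>

lemma Cauchy_Schwarz_integral:
  fixes f g :: "'a \<Rightarrow> real"
  assumes [measurable]: "f \<in> borel_measurable M" "g \<in> borel_measurable M"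
    and f: "integrable M (\<lambda>x. (f x)\<^sup>2)" and g: "integrable M (\<lambda>x. (g x)\<^sup>2)"
  shows "(\<integral>x. f x * g x \<partial>M)\<^sup>2 \<le> (\<integral>x. (f x)\<^sup>2 \<partial>M) * (\<integral>x. (g x)\<^sup>2 \<partial>M)"
proof -
  define A B C where "A = (\<integral>x. (f x)\<^sup>2 \<partial>M)" and "B = (\<integral>x. f x * g x \<partial>M)"
    and "C = (\<integral>x. (g x)\<^sup>2 \<partial>M)"
  have fg: "integrable M (\<lambda>x. f x * g x)"
    using assms by (rule integrable_mult_square_integrable)
  have quad: "0 \<le> A - 2 * t * B + t\<^sup>2 * C" for t
  proof -
    have "0 \<le> (\<integral>x. (f x - t * g x)\<^sup>2 \<partial>M)" by simp
    also have "\<dots> = (\<integral>x. (f x)\<^sup>2 - (2 * t) * (f x * g x) + t\<^sup>2 * (g x)\<^sup>2 \<partial>M)"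
      by (rule Bochner_Integration.integral_cong) (auto simp: power2_eq_square algebra_simps)
    also have "\<dots> = A - 2 * t * B + t\<^sup>2 * C"
      unfolding A_def B_def C_def using f g fg by simp
    finally show ?thesis .
  qed
  have "C \<ge> 0" unfolding C_def by simp
  show ?thesis
  proof (cases "C = 0")
    case True
    \<comment> \<open>With C = 0 the polynomial is affine in t. If B were nonzero, the chosen t
      would give it the value A - (A + 1) = -1.\<close>
    have "B = 0"
      using quad[of "(A + 1) / (2 * B)"] True by (cases "B = 0") auto
    then show ?thesis using True by (simp add: A_def B_def C_def)
  next
    case False
    then have "C > 0" using \<open>C \<ge> 0\<close> by simp
    have "A - 2 * (B / C) * B + (B / C)\<^sup>2 * C = A - B\<^sup>2 / C"
      using False by (simp add: power2_eq_square field_simps)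
    then have "B\<^sup>2 / C \<le> A" using quad[of "B / C"] by simp
    then have "B\<^sup>2 \<le> A * C" using \<open>C > 0\<close> by (simp add: pos_divide_le_eq)
    then show ?thesis by (simp add: A_def B_def C_def)
  qed
qed

section \<open>The symmetric edge measure and its disintegration\<close>

locale reversible_walk =
  fixes m :: "'a \<Rightarrow> 'a measure" and \<nu> :: "'a measure"
  assumes walk: "reversible_random_walk_space m \<nu>"
    and space_nonempty: "space \<nu> \<noteq> {}"
begin

text \<open>A \<open>bind\<close> of the image kernels under \<open>Pair x\<close>, so that the
  integral and null-set rules for \<open>bind\<close> apply although \<nu> may be infinite. On an
  empty space \<open>bind\<close> returns a default measure, which \<open>space_nonempty\<close>
  excludes.\<close>

definition edge_measure :: "('a \<times> 'a) measure" where
  "edge_measure = \<nu> \<bind> (\<lambda>x. distr (m x) (\<nu> \<Otimes>\<^sub>M \<nu>) (Pair x))"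

lemma prob_space_step: "x \<in> space \<nu> \<Longrightarrow> prob_space (m x)"
  and sets_step: "x \<in> space \<nu> \<Longrightarrow> sets (m x) = sets \<nu>"
  and step_measurable: "B \<in> sets \<nu> \<Longrightarrow> (\<lambda>x. emeasure (m x) B) \<in> borel_measurable \<nu>"
  using walk unfolding reversible_random_walk_space_def random_walk_def by auto

lemma space_step: "x \<in> space \<nu> \<Longrightarrow> space (m x) = space \<nu>"
  using sets_step sets_eq_imp_space_eq by blast

lemma borel_measurable_step:
  "x \<in> space \<nu> \<Longrightarrow> f \<in> borel_measurable \<nu> \<Longrightarrow> f \<in> borel_measurable (m x)"
  by (simp add: measurable_cong_sets[OF sets_step refl])

lemma kernel[measurable]: "m \<in> measurable \<nu> (subprob_algebra \<nu>)"
  by (rule measurable_subprob_algebra)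
    (auto simp: sets_step step_measurable intro!: prob_space_imp_subprob_space prob_space_step)

lemma edge_kernel[measurable]:
  "(\<lambda>x. distr (m x) (\<nu> \<Otimes>\<^sub>M \<nu>) (Pair x)) \<in> measurable \<nu> (subprob_algebra (\<nu> \<Otimes>\<^sub>M \<nu>))"
  by (rule measurable_distr2[where M=\<nu>]) simp_all

lemma sets_edge_measure[simp, measurable_cong]: "sets edge_measure = sets (\<nu> \<Otimes>\<^sub>M \<nu>)"
  unfolding edge_measure_def using space_nonempty by simp

lemma measurable_edge_measure: "measurable edge_measure N = measurable (\<nu> \<Otimes>\<^sub>M \<nu>) N"
  by (rule measurable_cong_sets) simp_all

lemma space_edge_measure: "space edge_measure = space \<nu> \<times> space \<nu>"
  using sets_eq_imp_space_eq[OF sets_edge_measure] by (simp add: space_pair_measure)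

lemma Pair_measurable_step: "x \<in> space \<nu> \<Longrightarrow> Pair x \<in> measurable (m x) (\<nu> \<Otimes>\<^sub>M \<nu>)"
  by (simp add: measurable_cong_sets[OF sets_step refl])

lemma nn_integral_edge_measure:
  assumes [measurable]: "h \<in> borel_measurable (\<nu> \<Otimes>\<^sub>M \<nu>)"
  shows "(\<integral>\<^sup>+p. h p \<partial>edge_measure) = (\<integral>\<^sup>+x. \<integral>\<^sup>+y. h (x, y) \<partial>m x \<partial>\<nu>)"
proof -
  have "(\<integral>\<^sup>+p. h p \<partial>edge_measure)
      = (\<integral>\<^sup>+x. \<integral>\<^sup>+p. h p \<partial>distr (m x) (\<nu> \<Otimes>\<^sub>M \<nu>) (Pair x) \<partial>\<nu>)"
    unfolding edge_measure_def by (rule nn_integral_bind[where B="\<nu> \<Otimes>\<^sub>M \<nu>"]) simp_all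
  also have "\<dots> = (\<integral>\<^sup>+x. \<integral>\<^sup>+y. h (x, y) \<partial>m x \<partial>\<nu>)"
    by (rule nn_integral_cong) (simp add: nn_integral_distr Pair_measurable_step)
  finally show ?thesis .
qed

lemma AE_edge_measure:
  assumes [measurable]: "Measurable.pred (\<nu> \<Otimes>\<^sub>M \<nu>) P"
  shows "(AE p in edge_measure. P p) \<longleftrightarrow> (AE x in \<nu>. AE y in m x. P (x, y))"
proof -
  have "(AE p in edge_measure. P p)
      \<longleftrightarrow> (AE x in \<nu>. AE p in distr (m x) (\<nu> \<Otimes>\<^sub>M \<nu>) (Pair x). P p)"
    unfolding edge_measure_def by (rule AE_bind[where B="\<nu> \<Otimes>\<^sub>M \<nu>"]) simp_all
  also have "\<dots> \<longleftrightarrow> (AE x in \<nu>. AE y in m x. P (x, y))"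
    by (rule AE_cong) (simp add: AE_distr_iff Pair_measurable_step)
  finally show ?thesis .
qed

text \<open>\<open>P\<close> may be nonmeasurable here: its failures lie in a measurable null set
  \<open>N\<close>, and the rule for measurable predicates is applied to the complement of
  \<open>N\<close>.\<close>

lemma AE_edge_measureD:
  assumes "AE p in edge_measure. P p"
  shows "AE x in \<nu>. AE y in m x. P (x, y)"
proof -
  obtain N where N: "{p \<in> space edge_measure. \<not> P p} \<subseteq> N" "N \<in> null_sets edge_measure"
    using assms unfolding eventually_ae_filter by blast
  then have [measurable]: "N \<in> sets (\<nu> \<Otimes>\<^sub>M \<nu>)" by auto
  have "AE p in edge_measure. p \<notin> N" using N(2) by (rule AE_not_in)
  then have "AE x in \<nu>. AE y in m x. (x, y) \<notin> N" by (subst (asm) AE_edge_measure) auto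
  then show ?thesis
    using AE_space
  proof eventually_elim
    case (elim x)
    show ?case
      using elim(1) AE_space
      by eventually_elim (use N(1) elim(2) in \<open>auto simp: space_edge_measure space_step\<close>)
  qed
qed

text \<open>This is where reversibility enters: after disintegration, the two sides are the two
  double integrals in the definition of \<open>reversible\<close>.\<close>

lemma distr_edge_measure_swap:
  "distr edge_measure (\<nu> \<Otimes>\<^sub>M \<nu>) (\<lambda>(x, y). (y, x)) = edge_measure"
proof (rule measure_eqI)
  fix C assume "C \<in> sets (distr edge_measure (\<nu> \<Otimes>\<^sub>M \<nu>) (\<lambda>(x, y). (y, x)))"
  then have C[measurable]: "C \<in> sets (\<nu> \<Otimes>\<^sub>M \<nu>)" by simp
  have "emeasure (distr edge_measure (\<nu> \<Otimes>\<^sub>M \<nu>) (\<lambda>(x, y). (y, x))) C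
      = (\<integral>\<^sup>+p. indicator C p \<partial>distr edge_measure (\<nu> \<Otimes>\<^sub>M \<nu>) (\<lambda>(x, y). (y, x)))"
    by (rule nn_integral_indicator[symmetric]) simp
  also have "\<dots> = (\<integral>\<^sup>+p. indicator C ((\<lambda>(x, y). (y, x)) p) \<partial>edge_measure)"
    by (rule nn_integral_distr) simp_all
  also have "\<dots> = (\<integral>\<^sup>+y. \<integral>\<^sup>+x. indicator C (x, y) \<partial>m y \<partial>\<nu>)"
    by (subst nn_integral_edge_measure) simp_all
  also have "\<dots> = (\<integral>\<^sup>+x. \<integral>\<^sup>+y. indicator C (x, y) \<partial>m x \<partial>\<nu>)"
    using walk C unfolding reversible_random_walk_space_def reversible_def by simp
  also have "\<dots> = emeasure edge_measure C"
    by (subst nn_integral_edge_measure[symmetric]) simp_all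
  finally show "emeasure (distr edge_measure (\<nu> \<Otimes>\<^sub>M \<nu>) (\<lambda>(x, y). (y, x))) C
      = emeasure edge_measure C" .
qed simp

lemma distr_edge_measure_fst: "distr edge_measure \<nu> fst = \<nu>"
proof (rule measure_eqI)
  fix A assume "A \<in> sets (distr edge_measure \<nu> fst)"
  then have [measurable]: "A \<in> sets \<nu>" by simp
  have "emeasure (distr edge_measure \<nu> fst) A = (\<integral>\<^sup>+p. indicator A (fst p) \<partial>edge_measure)"
    by (subst nn_integral_distr[symmetric, where M'=\<nu>]) simp_all
  also have "\<dots> = (\<integral>\<^sup>+x. \<integral>\<^sup>+y. indicator A x \<partial>m x \<partial>\<nu>)"
    by (subst nn_integral_edge_measure) simp_all
  also have "\<dots> = (\<integral>\<^sup>+x. indicator A x \<partial>\<nu>)"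
    by (rule nn_integral_cong) (simp add: prob_space.emeasure_space_1 prob_space_step)
  finally show "emeasure (distr edge_measure \<nu> fst) A = emeasure \<nu> A" by simp
qed simp

text \<open>This is the invariance of \<nu> under the walk. It follows from the first marginal by
  the swap symmetry, and it carries \<nu>-almost-everywhere facts and integrability over to the
  endpoint of a step.\<close>

lemma distr_edge_measure_snd: "distr edge_measure \<nu> snd = \<nu>"
proof -
  have "distr edge_measure \<nu> snd = distr edge_measure \<nu> (fst \<circ> (\<lambda>(x, y). (y, x)))"
    by (rule distr_cong) auto
  also have "\<dots> = distr (distr edge_measure (\<nu> \<Otimes>\<^sub>M \<nu>) (\<lambda>(x, y). (y, x))) \<nu> fst"
    by (rule distr_distr[symmetric]) simp_all
  finally show ?thesis by (simp add: distr_edge_measure_swap distr_edge_measure_fst)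
qed

lemma AE_edge_fst: "AE x in \<nu>. P x \<Longrightarrow> AE p in edge_measure. P (fst p)"
  using AE_distrD[of fst edge_measure \<nu> P] unfolding distr_edge_measure_fst by simp

lemma AE_edge_snd: "AE x in \<nu>. P x \<Longrightarrow> AE p in edge_measure. P (snd p)"
  using AE_distrD[of snd edge_measure \<nu> P] unfolding distr_edge_measure_snd by simp

lemma AE_edge_swap: "AE p in edge_measure. P p \<Longrightarrow> AE p in edge_measure. P (snd p, fst p)"
  using AE_distrD[of "\<lambda>(x, y). (y, x)" edge_measure "\<nu> \<Otimes>\<^sub>M \<nu>" P]
  unfolding distr_edge_measure_swap by (simp add: case_prod_beta)

lemma integrable_edge_fst:
  fixes f :: "'a \<Rightarrow> real"
  shows "integrable \<nu> f \<Longrightarrow> integrable edge_measure (\<lambda>p. f (fst p))"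
  using integrable_distr[of fst edge_measure \<nu> f] unfolding distr_edge_measure_fst by simp

lemma integrable_edge_snd:
  fixes f :: "'a \<Rightarrow> real"
  shows "integrable \<nu> f \<Longrightarrow> integrable edge_measure (\<lambda>p. f (snd p))"
  using integrable_distr[of snd edge_measure \<nu> f] unfolding distr_edge_measure_snd by simp

lemma integral_edge_swap:
  fixes h :: "'a \<times> 'a \<Rightarrow> real"
  assumes "h \<in> borel_measurable (\<nu> \<Otimes>\<^sub>M \<nu>)"
  shows "(\<integral>p. h (snd p, fst p) \<partial>edge_measure) = (\<integral>p. h p \<partial>edge_measure)"
  using integral_distr[of "\<lambda>(x, y). (y, x)" edge_measure "\<nu> \<Otimes>\<^sub>M \<nu>" h] assms
  unfolding distr_edge_measure_swap by (simp add: case_prod_beta)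

text \<open>Fubini's theorem for a kernel, obtained from the extended nonnegative version: a finite
  total integral forces the inner integral \<open>H\<close> to be finite almost everywhere.\<close>

lemma integral_edge_measure_nonneg:
  fixes h :: "'a \<times> 'a \<Rightarrow> real"
  assumes h: "integrable edge_measure h" and nonneg: "\<And>p. 0 \<le> h p"
  shows "AE x in \<nu>. integrable (m x) (\<lambda>y. h (x, y))" (is ?AE)
    and "integrable \<nu> (\<lambda>x. \<integral>y. h (x, y) \<partial>m x)" (is ?int)
    and "(\<integral>x. \<integral>y. h (x, y) \<partial>m x \<partial>\<nu>) = (\<integral>p. h p \<partial>edge_measure)" (is ?eq)
proof -
  have [measurable]: "h \<in> borel_measurable (\<nu> \<Otimes>\<^sub>M \<nu>)"
    using borel_measurable_integrable[OF h] unfolding measurable_edge_measure .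
  have meas: "(\<lambda>y. h (x, y)) \<in> borel_measurable (m x)" if "x \<in> space \<nu>" for x
    by (rule borel_measurable_step[OF that], rule measurable_compose[OF measurable_Pair1'[OF that]]) simp
  define H where "H x = (\<integral>\<^sup>+y. ennreal (h (x, y)) \<partial>m x)" for x
  have [measurable]: "H \<in> borel_measurable \<nu>"
    unfolding H_def by (rule nn_integral_measurable_subprob_algebra2[where N=\<nu>]) simp_all
  have H_int: "(\<integral>\<^sup>+x. H x \<partial>\<nu>) = ennreal (\<integral>p. h p \<partial>edge_measure)"
    using nn_integral_edge_measure[of "\<lambda>p. ennreal (h p)"] nn_integral_eq_integral[OF h] nonneg
    unfolding H_def by simp
  then have fin: "AE x in \<nu>. H x \<noteq> \<infinity>"
    by (intro nn_integral_PInf_AE) simp_all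
  then show ?AE
    using AE_space
  proof eventually_elim
    case (elim x)
    then show ?case
      using meas[of x] nonneg unfolding H_def by (intro integrableI_nonneg) (auto simp: less_top[symmetric])
  qed
  \<comment> \<open>This holds even where \<open>H x\<close> is infinite: the Bochner integral is
    then 0 by default, and so is \<open>enn2real\<close> of infinity.\<close>
  have inner: "(\<integral>y. h (x, y) \<partial>m x) = enn2real (H x)" if "x \<in> space \<nu>" for x
    unfolding H_def using meas[OF that] nonneg by (intro integral_eq_nn_integral) auto
  have eq: "(\<integral>\<^sup>+x. ennreal (enn2real (H x)) \<partial>\<nu>) = (\<integral>\<^sup>+x. H x \<partial>\<nu>)"
    by (rule nn_integral_cong_AE) (use fin in \<open>auto simp: less_top\<close>)
  have "integrable \<nu> (\<lambda>x. enn2real (H x))"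
    by (rule integrableI_nonneg) (auto simp: eq H_int)
  then show ?int
    by (subst Bochner_Integration.integrable_cong[OF refl inner])
  have "(\<integral>x. enn2real (H x) \<partial>\<nu>) = (\<integral>p. h p \<partial>edge_measure)"
    by (subst integral_eq_nn_integral) (auto simp: eq H_int nonneg)
  then show ?eq
    by (subst Bochner_Integration.integral_cong[OF refl inner])
qed

lemma integral_edge_measure:
  fixes h :: "'a \<times> 'a \<Rightarrow> real"
  assumes h: "integrable edge_measure h"
  shows "AE x in \<nu>. integrable (m x) (\<lambda>y. h (x, y))" (is ?AE)
    and "integrable \<nu> (\<lambda>x. \<integral>y. h (x, y) \<partial>m x)" (is ?int)
    and "(\<integral>x. \<integral>y. h (x, y) \<partial>m x \<partial>\<nu>) = (\<integral>p. h p \<partial>edge_measure)" (is ?eq)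
proof -
  define a b where "a p = max 0 (h p)" and "b p = max 0 (- h p)" for p
  have hab: "h = (\<lambda>p. a p - b p)" by (auto simp: a_def b_def fun_eq_iff max_def)
  have a: "integrable edge_measure a" and b: "integrable edge_measure b"
    unfolding a_def b_def using h by auto
  have nn: "0 \<le> a p" "0 \<le> b p" for p by (auto simp: a_def b_def fun_eq_iff max_def)
  note A = integral_edge_measure_nonneg[OF a nn(1)] and B = integral_edge_measure_nonneg[OF b nn(2)]
  show ?AE using A(1) B(1) unfolding hab by eventually_elim simp
  have split: "AE x in \<nu>. (\<integral>y. a (x, y) \<partial>m x) - (\<integral>y. b (x, y) \<partial>m x) = (\<integral>y. h (x, y) \<partial>m x)"
    using A(1) B(1) unfolding hab by eventually_elim simp
  \<comment> \<open>The almost-everywhere identity \<open>split\<close> does not give measurability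
    of the inner integral. It comes from integrating \<open>h\<close> against the image kernels on
    the product space.\<close>
  have [measurable]: "(\<lambda>x. \<integral>y. h (x, y) \<partial>m x) \<in> borel_measurable \<nu>"
  proof -
    have [measurable]: "h \<in> borel_measurable (\<nu> \<Otimes>\<^sub>M \<nu>)"
      using borel_measurable_integrable[OF h] unfolding measurable_edge_measure .
    have "(\<lambda>x. \<integral>p. h p \<partial>distr (m x) (\<nu> \<Otimes>\<^sub>M \<nu>) (Pair x)) \<in> borel_measurable \<nu>"
      by measurable
    then show ?thesis
      by (subst measurable_cong[where g="\<lambda>x. \<integral>p. h p \<partial>distr (m x) (\<nu> \<Otimes>\<^sub>M \<nu>) (Pair x)"])
        (simp_all add: integral_distr Pair_measurable_step)
  qed
  have int: "integrable \<nu> (\<lambda>x. (\<integral>y. a (x, y) \<partial>m x) - (\<integral>y. b (x, y) \<partial>m x))"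
    using A(2) B(2) by simp
  show ?int
    by (rule integrable_cong_AE_imp[OF int _ split]) simp
  have "(\<integral>x. \<integral>y. h (x, y) \<partial>m x \<partial>\<nu>)
      = (\<integral>x. (\<integral>y. a (x, y) \<partial>m x) - (\<integral>y. b (x, y) \<partial>m x) \<partial>\<nu>)"
    using split borel_measurable_integrable[OF int] by (intro integral_cong_AE) auto
  also have "\<dots> = (\<integral>p. h p \<partial>edge_measure)"
    using A B a b by (simp add: hab)
  finally show ?eq .
qed

section \<open>Energy form and Green's formula\<close>

definition square_integrable :: "('a \<Rightarrow> real) \<Rightarrow> bool" where
  "square_integrable F \<longleftrightarrow> F \<in> borel_measurable \<nu> \<and> integrable \<nu> (\<lambda>x. (F x)\<^sup>2)"

text \<open>The inner product of the gradients in L2 of the edge measure. There is no factor 1/2, to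
  match \<open>grad_integral\<close>; each pair is seen in both orientations, whence the factor 2 in
  Green's formula.\<close>

definition energy :: "('a \<Rightarrow> real) \<Rightarrow> ('a \<Rightarrow> real) \<Rightarrow> real" where
  "energy F G = (\<integral>p. (F (snd p) - F (fst p)) * (G (snd p) - G (fst p)) \<partial>edge_measure)"

definition laplacian :: "('a \<Rightarrow> real) \<Rightarrow> 'a \<Rightarrow> real" where
  "laplacian F x = (\<integral>y. F y - F x \<partial>m x)"

lemma square_integrableD:
  assumes "square_integrable F"
  shows "F \<in> borel_measurable \<nu>" "integrable \<nu> (\<lambda>x. (F x)\<^sup>2)"
  using assms by (auto simp: square_integrable_def)

lemma edge_square_integrable:
  assumes "square_integrable F"
  shows "integrable edge_measure (\<lambda>p. (F (fst p))\<^sup>2)"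
    and "integrable edge_measure (\<lambda>p. (F (snd p))\<^sup>2)"
    and "integrable edge_measure (\<lambda>p. (F (snd p) - F (fst p))\<^sup>2)"
proof -
  have [measurable]: "F \<in> borel_measurable \<nu>" using assms by (rule square_integrableD)
  note F = square_integrableD(2)[OF assms]
  show 1: "integrable edge_measure (\<lambda>p. (F (fst p))\<^sup>2)" using F by (rule integrable_edge_fst)
  show 2: "integrable edge_measure (\<lambda>p. (F (snd p))\<^sup>2)" using F by (rule integrable_edge_snd)
  have 3: "integrable edge_measure (\<lambda>p. F (fst p) * F (snd p))"
    using 1 2 by (intro integrable_mult_square_integrable) simp_all
  have "integrable edge_measure (\<lambda>p. (F (snd p))\<^sup>2 + (F (fst p))\<^sup>2 - 2 * (F (fst p) * F (snd p)))"
    using 1 2 3 by simp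
  then show "integrable edge_measure (\<lambda>p. (F (snd p) - F (fst p))\<^sup>2)"
    by (rule Bochner_Integration.integrable_cong[THEN iffD1, rotated 2])
      (simp_all add: power2_eq_square algebra_simps)
qed

lemma edge_difference_integrable:
  assumes "square_integrable F" "square_integrable G"
  shows "integrable edge_measure (\<lambda>p. (F (snd p) - F (fst p)) * G (fst p))"
    and "integrable edge_measure (\<lambda>p. (F (snd p) - F (fst p)) * G (snd p))"
proof -
  have [measurable]: "F \<in> borel_measurable \<nu>" "G \<in> borel_measurable \<nu>"
    using assms by (simp_all add: square_integrableD)
  show "integrable edge_measure (\<lambda>p. (F (snd p) - F (fst p)) * G (fst p))"
    "integrable edge_measure (\<lambda>p. (F (snd p) - F (fst p)) * G (snd p))"
    by (intro integrable_mult_square_integrable edge_square_integrable assms; simp)+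
qed

lemma laplacian_integrable:
  assumes "square_integrable F" "square_integrable G"
  shows "integrable \<nu> (\<lambda>x. laplacian F x * G x)"
  using integral_edge_measure(2)[OF edge_difference_integrable(1)[OF assms]]
  by (simp add: laplacian_def)

text \<open>Expand the gradient of \<open>G\<close> into its two endpoint terms. Swapping the edge
  turns the term with G(y) into the negative of the term with G(x), and disintegrating the latter
  produces the Laplacian.\<close>

lemma green:
  assumes "square_integrable F" "square_integrable G"
  shows "energy F G = - 2 * (\<integral>x. laplacian F x * G x \<partial>\<nu>)"
proof -
  have [measurable]: "F \<in> borel_measurable \<nu>" "G \<in> borel_measurable \<nu>"
    using assms by (simp_all add: square_integrableD)
  note int = edge_difference_integrable[OF assms]
  have "energy F G = (\<integral>p. (F (snd p) - F (fst p)) * G (snd p) \<partial>edge_measure)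
      - (\<integral>p. (F (snd p) - F (fst p)) * G (fst p) \<partial>edge_measure)"
    unfolding energy_def right_diff_distrib by (rule Bochner_Integration.integral_diff[OF int(2,1)])
  also have "(\<integral>p. (F (snd p) - F (fst p)) * G (snd p) \<partial>edge_measure)
      = (\<integral>p. (F (fst p) - F (snd p)) * G (fst p) \<partial>edge_measure)"
    using integral_edge_swap[of "\<lambda>p. (F (snd p) - F (fst p)) * G (snd p)"] by simp
  also have "\<dots> = - (\<integral>p. (F (snd p) - F (fst p)) * G (fst p) \<partial>edge_measure)"
    by (subst Bochner_Integration.integral_minus[symmetric])
      (rule Bochner_Integration.integral_cong, simp_all add: algebra_simps)
  also have "(\<integral>p. (F (snd p) - F (fst p)) * G (fst p) \<partial>edge_measure)
      = (\<integral>x. laplacian F x * G x \<partial>\<nu>)"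
    using integral_edge_measure(3)[OF int(1)] by (simp add: laplacian_def)
  finally show ?thesis by simp
qed

lemma energy_Cauchy_Schwarz:
  assumes "square_integrable F" "square_integrable G"
  shows "(energy F G)\<^sup>2 \<le> energy F F * energy G G"
proof -
  have [measurable]: "F \<in> borel_measurable \<nu>" "G \<in> borel_measurable \<nu>"
    using assms by (simp_all add: square_integrableD)
  show ?thesis
    unfolding energy_def power2_eq_square[symmetric, where 'a=real]
    using Cauchy_Schwarz_integral[OF _ _ edge_square_integrable(3)[OF assms(1)]
        edge_square_integrable(3)[OF assms(2)]]
    by (simp add: power2_eq_square)
qed

lemma energy_nonneg: "0 \<le> energy F F"
  unfolding energy_def by simp

end

section \<open>Extension by zero outside the domain\<close>

locale walk_domain = reversible_walk +
  fixes \<Omega> :: "'a set"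
  assumes domain_sets[measurable]: "\<Omega> \<in> sets \<nu>"
begin

abbreviation "\<Omega>\<^sub>m \<equiv> m_closure m \<nu> \<Omega>"

text \<open>An element of L2 on \<open>\<Omega>\<^sub>m\<close> has arbitrary values elsewhere. For
  functions vanishing on the boundary, \<open>cut f\<close> is a representative of the same class
  that is defined globally and supported in \<Omega>, so the energy calculus on the whole space
  applies to it.\<close>

definition cut :: "('a \<Rightarrow> real) \<Rightarrow> 'a \<Rightarrow> real" where
  "cut f x = indicator \<Omega> x * f x"

lemma closure_sets[measurable]: "\<Omega>\<^sub>m \<in> sets \<nu>"
proof -
  have [measurable]: "(\<lambda>x. emeasure (m x) \<Omega>) \<in> borel_measurable \<nu>"
    by (rule step_measurable) simp
  have "m_boundary m \<nu> \<Omega> = {x \<in> space \<nu>. x \<notin> \<Omega> \<and> 0 < emeasure (m x) \<Omega>}"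
    by (auto simp: m_boundary_def)
  also have "\<dots> \<in> sets \<nu>" by measurable
  finally show ?thesis unfolding m_closure_def by simp
qed

text \<open>A point x outside \<open>\<Omega>\<^sub>m\<close> has \<open>m x\<close>-measure 0 on
  \<Omega>, by the definition of the boundary, so almost no edge leads from there into \<Omega>.
  Symmetry of the edge measure gives the other orientation.\<close>

lemma AE_edge_closure:
  "AE p in edge_measure. (fst p \<in> \<Omega> \<longrightarrow> snd p \<in> \<Omega>\<^sub>m) \<and> (snd p \<in> \<Omega> \<longrightarrow> fst p \<in> \<Omega>\<^sub>m)"
proof -
  have "AE x in \<nu>. AE y in m x. snd (x, y) \<in> \<Omega> \<longrightarrow> fst (x, y) \<in> \<Omega>\<^sub>m"
  proof (rule AE_I2)
    fix x assume x: "x \<in> space \<nu>"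
    show "AE y in m x. snd (x, y) \<in> \<Omega> \<longrightarrow> fst (x, y) \<in> \<Omega>\<^sub>m"
    proof (cases "x \<in> \<Omega>\<^sub>m")
      case False
      then have "\<Omega> \<in> null_sets (m x)"
        using x by (auto simp: m_closure_def m_boundary_def sets_step null_sets_def zero_less_iff_neq_zero)
      then have "AE y in m x. y \<notin> \<Omega>" by (rule AE_not_in)
      then show ?thesis by eventually_elim simp
    qed simp
  qed
  then have 1: "AE p in edge_measure. snd p \<in> \<Omega> \<longrightarrow> fst p \<in> \<Omega>\<^sub>m"
    by (subst AE_edge_measure) simp_all
  show ?thesis using 1 AE_edge_swap[OF 1] by eventually_elim simp
qed

lemma closure_representative:
  assumes "f \<in> L2_vanishing m \<nu> \<Omega>"
  shows "square_integrable (\<lambda>x. indicator \<Omega>\<^sub>m x * f x)"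
proof -
  have f: "f \<in> borel_measurable (restrict_space \<nu> \<Omega>\<^sub>m)"
    "integrable (restrict_space \<nu> \<Omega>\<^sub>m) (\<lambda>x. (f x)\<^sup>2)"
    using assms by (auto simp: L2_vanishing_def L2_def)
  have "integrable \<nu> (\<lambda>x. indicator \<Omega>\<^sub>m x *\<^sub>R (f x)\<^sup>2)"
    using f(2) by (subst (asm) integrable_restrict_space) simp_all
  moreover have "indicator \<Omega>\<^sub>m x *\<^sub>R (f x)\<^sup>2 = (indicator \<Omega>\<^sub>m x * f x)\<^sup>2" for x
    by (simp add: indicator_def)
  ultimately show ?thesis
    using f(1) unfolding square_integrable_def
    by (subst (asm) borel_measurable_restrict_space_iff) simp_all
qed

lemma cut_square_integrable:
  assumes "f \<in> L2_vanishing m \<nu> \<Omega>"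
  shows "square_integrable (cut f)"
proof -
  define g where "g x = indicator \<Omega>\<^sub>m x * f x" for x
  have g: "square_integrable g" unfolding g_def by (rule closure_representative[OF assms])
  have [measurable]: "g \<in> borel_measurable \<nu>" using g by (rule square_integrableD)
  have cut: "cut f = (\<lambda>x. indicator \<Omega> x * g x)"
    by (auto simp: cut_def g_def m_closure_def indicator_def)
  have "integrable \<nu> (\<lambda>x. (indicator \<Omega> x * g x)\<^sup>2)"
    by (rule Bochner_Integration.integrable_bound[OF square_integrableD(2)[OF g]])
      (auto simp: indicator_def)
  then show ?thesis unfolding square_integrable_def cut by simp
qed

lemma AE_eq_cut:
  assumes "f \<in> L2_vanishing m \<nu> \<Omega>"
  shows "AE x in \<nu>. x \<in> \<Omega>\<^sub>m \<longrightarrow> f x = cut f x"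
proof -
  have "AE x in \<nu>. x \<in> m_boundary m \<nu> \<Omega> \<longrightarrow> f x = 0"
    using assms by (simp add: L2_vanishing_def)
  then show ?thesis
    by eventually_elim (auto simp: cut_def m_closure_def m_boundary_def)
qed

lemma supported_in_L2_vanishing:
  assumes "square_integrable F" and supp: "\<And>x. x \<notin> \<Omega> \<Longrightarrow> F x = 0"
  shows "F \<in> L2_vanishing m \<nu> \<Omega>" "cut F = F"
proof -
  note F = square_integrableD[OF assms(1)]
  have "integrable \<nu> (\<lambda>x. indicator \<Omega>\<^sub>m x *\<^sub>R (F x)\<^sup>2)"
    using F by (intro integrable_mult_indicator) simp_all
  then have "integrable (restrict_space \<nu> \<Omega>\<^sub>m) (\<lambda>x. (F x)\<^sup>2)"
    by (subst integrable_restrict_space) simp_all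
  then show "F \<in> L2_vanishing m \<nu> \<Omega>"
    using F(1) supp by (auto simp: L2_vanishing_def L2_def m_boundary_def measurable_restrict_space1)
  show "cut F = F" using supp by (auto simp: cut_def fun_eq_iff indicator_def)
qed

text \<open>An edge that is not contained in \<open>\<Omega>\<^sub>m\<close> has almost surely no
  endpoint in \<Omega>, so the gradient of \<open>cut f\<close> vanishes on it. On the remaining
  edges \<open>f\<close> and \<open>cut f\<close> agree almost everywhere.\<close>

lemma grad_integral_eq_energy:
  assumes f: "f \<in> L2_vanishing m \<nu> \<Omega>"
  shows "grad_integral m \<nu> \<Omega> f = energy (cut f) (cut f)"
proof -
  define g where "g x = indicator \<Omega>\<^sub>m x * f x" for x
  define h where "h p = indicator (\<Omega>\<^sub>m \<times> \<Omega>\<^sub>m) p * (g (snd p) - g (fst p))\<^sup>2" for p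
  have g: "square_integrable g" unfolding g_def by (rule closure_representative[OF f])
  have [measurable]: "g \<in> borel_measurable \<nu>" using g by (rule square_integrableD)
  have [measurable]: "cut f \<in> borel_measurable \<nu>"
    using cut_square_integrable[OF f] by (rule square_integrableD)
  have [measurable]: "h \<in> borel_measurable (\<nu> \<Otimes>\<^sub>M \<nu>)" unfolding h_def by measurable
  have h: "integrable edge_measure h"
    by (rule Bochner_Integration.integrable_bound[OF edge_square_integrable(3)[OF g]])
      (auto simp: h_def indicator_def)
  \<comment> \<open>Replacing \<open>f\<close> by \<open>g\<close> changes nothing on
    \<open>\<Omega>\<^sub>m\<close>, but makes the integrand measurable on the product space, as
    disintegration requires.\<close>
  have "grad_integral m \<nu> \<Omega> f = (\<integral>x. \<integral>y. h (x, y) \<partial>m x \<partial>\<nu>)"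
    unfolding grad_integral_def set_lebesgue_integral_def grad_def
  proof (rule Bochner_Integration.integral_cong[OF refl])
    fix x
    show "indicator \<Omega>\<^sub>m x *\<^sub>R (\<integral>y. indicator \<Omega>\<^sub>m y *\<^sub>R \<bar>f y - f x\<bar>\<^sup>2 \<partial>m x) = (\<integral>y. h (x, y) \<partial>m x)"
    proof (cases "x \<in> \<Omega>\<^sub>m")
      case True
      then show ?thesis
        by (simp, intro Bochner_Integration.integral_cong[OF refl])
          (auto simp: h_def g_def indicator_def)
    qed (simp add: h_def)
  qed
  also have "\<dots> = (\<integral>p. h p \<partial>edge_measure)" by (rule integral_edge_measure(3)[OF h])
  also have "\<dots> = energy (cut f) (cut f)"
    unfolding energy_def
  proof (rule integral_cong_AE)
    show "AE p in edge_measure.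
        h p = (cut f (snd p) - cut f (fst p)) * (cut f (snd p) - cut f (fst p))"
      using AE_edge_closure AE_edge_fst[OF AE_eq_cut[OF f]] AE_edge_snd[OF AE_eq_cut[OF f]]
    proof eventually_elim
      case (elim p)
      then show ?case
        by (cases p; cases "fst p \<in> \<Omega>\<^sub>m"; cases "snd p \<in> \<Omega>\<^sub>m")
          (auto simp: h_def g_def cut_def power2_eq_square indicator_def m_closure_def split: if_splits)
    qed
  qed simp_all
  finally show ?thesis .
qed

text \<open>From almost every x in \<Omega> the step stays in \<open>\<Omega>\<^sub>m\<close> almost
  surely, so integrating over \<open>\<Omega>\<^sub>m\<close> is the same as integrating over the
  whole space. The second marginal ensures that f(y) = \<open>cut f y\<close> for almost every such
  step.\<close>

lemma AE_laplacian_cut: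
  assumes f: "f \<in> L2_vanishing m \<nu> \<Omega>"
  shows "AE x in \<nu>. x \<in> \<Omega> \<longrightarrow> (LINT y:\<Omega>\<^sub>m|m x. (f y - f x)) = laplacian (cut f) x"
proof -
  define g where "g x = indicator \<Omega>\<^sub>m x * f x" for x
  have g: "g \<in> borel_measurable \<nu>"
    using closure_representative[OF f] unfolding g_def[abs_def] by (rule square_integrableD)
  have cut: "cut f \<in> borel_measurable \<nu>"
    using cut_square_integrable[OF f] by (rule square_integrableD)
  show ?thesis
    using AE_edge_measureD[OF AE_edge_closure] AE_edge_measureD[OF AE_edge_snd[OF AE_eq_cut[OF f]]] AE_space
  proof eventually_elim
    case (elim x)
    have sets[measurable]: "\<Omega>\<^sub>m \<in> sets (m x)" using elim(3) by (simp add: sets_step)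
    have [measurable]: "g \<in> borel_measurable (m x)" "cut f \<in> borel_measurable (m x)"
      using elim(3) g cut by (simp_all add: borel_measurable_step)
    show ?case
    proof
      assume x: "x \<in> \<Omega>"
      have "(LINT y:\<Omega>\<^sub>m|m x. (f y - f x)) = (\<integral>y. g y - indicator \<Omega>\<^sub>m y * f x \<partial>m x)"
        unfolding set_lebesgue_integral_def
        by (rule Bochner_Integration.integral_cong) (auto simp: g_def algebra_simps)
      also have "\<dots> = laplacian (cut f) x"
        unfolding laplacian_def
      proof (rule integral_cong_AE)
        show "AE y in m x. g y - indicator \<Omega>\<^sub>m y * f x = cut f y - cut f x"
          using elim(1,2) by eventually_elim (use x in \<open>auto simp: g_def cut_def\<close>)
      qed simp_all
      finally show "(LINT y:\<Omega>\<^sub>m|m x. (f y - f x)) = laplacian (cut f) x" .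
    qed
  qed
qed

section \<open>Weak form of the stress equation\<close>

lemma stress_function_imp_L2_vanishing:
  "is_stress_function m \<nu> \<Omega> f \<Longrightarrow> f \<in> L2_vanishing m \<nu> \<Omega>"
  by (simp add: is_stress_function_def L2_vanishing_def)

lemma AE_laplacian_stress_function:
  assumes "is_stress_function m \<nu> \<Omega> f"
  shows "AE x in \<nu>. x \<in> \<Omega> \<longrightarrow> laplacian (cut f) x = -1"
proof -
  have "AE x in \<nu>. x \<in> \<Omega> \<longrightarrow> - (LINT y:\<Omega>\<^sub>m|m x. (f y - f x)) = 1"
    using assms by (simp add: is_stress_function_def)
  with AE_laplacian_cut[OF stress_function_imp_L2_vanishing[OF assms]] show ?thesis
    by eventually_elim auto
qed

text \<open>Green's formula applies to the cut functions. The Laplacian of \<open>cut f\<close> is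
  known only on \<Omega>, which suffices because \<open>cut g\<close> is supported there.\<close>

lemma energy_stress_function:
  assumes f: "is_stress_function m \<nu> \<Omega> f" and g: "g \<in> L2_vanishing m \<nu> \<Omega>"
  shows "energy (cut f) (cut g) = 2 * (LINT x:\<Omega>|\<nu>. g x)"
proof -
  note sf = cut_square_integrable[OF stress_function_imp_L2_vanishing[OF f]]
  note sg = cut_square_integrable[OF g]
  have [measurable]: "cut g \<in> borel_measurable \<nu>" using sg by (rule square_integrableD)
  have "(\<integral>x. laplacian (cut f) x * cut g x \<partial>\<nu>) = (\<integral>x. - cut g x \<partial>\<nu>)"
  proof (rule integral_cong_AE)
    show "AE x in \<nu>. laplacian (cut f) x * cut g x = - cut g x"
      using AE_laplacian_stress_function[OF f]
      by eventually_elim (auto simp: cut_def indicator_def)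
  qed (use borel_measurable_integrable[OF laplacian_integrable[OF sf sg]] in simp_all)
  then show ?thesis
    using green[OF sf sg] by (simp add: set_lebesgue_integral_def cut_def)
qed

section \<open>Monotone iteration for the stress equation\<close>

primrec torsion_iterate :: "nat \<Rightarrow> 'a \<Rightarrow> ennreal" where
  "torsion_iterate 0 = (\<lambda>_. 0)"
| "torsion_iterate (Suc n) = (\<lambda>x. indicator \<Omega> x * (1 + (\<integral>\<^sup>+y. torsion_iterate n y \<partial>m x)))"

lemma torsion_iterate_measurable[measurable]: "torsion_iterate n \<in> borel_measurable \<nu>"
proof (induction n)
  case (Suc n)
  have [measurable]: "(\<lambda>x. \<integral>\<^sup>+y. torsion_iterate n y \<partial>m x) \<in> borel_measurable \<nu>"
    by (rule measurable_compose[OF kernel nn_integral_measurable_subprob_algebra[OF Suc]])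
  show ?case by simp
qed simp

lemma torsion_iterate_outside: "x \<notin> \<Omega> \<Longrightarrow> torsion_iterate n x = 0"
  by (cases n) simp_all

lemma torsion_iterate_mono: "torsion_iterate n x \<le> torsion_iterate (Suc n) x"
proof (induction n arbitrary: x)
  case (Suc n)
  have "(\<integral>\<^sup>+y. torsion_iterate n y \<partial>m x) \<le> (\<integral>\<^sup>+y. torsion_iterate (Suc n) y \<partial>m x)"
    by (intro nn_integral_mono Suc)
  then show ?case unfolding torsion_iterate.simps(2)[of "Suc n"]
    by (subst torsion_iterate.simps(2)) (intro mult_left_mono add_left_mono, simp_all)
qed simp

lemma incseq_torsion_iterate: "incseq torsion_iterate"
  by (intro incseq_SucI le_funI torsion_iterate_mono)

text \<open>Probabilistically, the iterate is the mean of min(tau, n), where tau is the exit time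
  from \<Omega>. The bound grows with n; its purpose is to make each iterate finite, and square
  integrable once \<Omega> has finite measure.\<close>

lemma torsion_iterate_le: "torsion_iterate n x \<le> of_nat n"
proof (induction n arbitrary: x)
  case (Suc n)
  show ?case
  proof (cases "x \<in> \<Omega>")
    case True
    then have "x \<in> space \<nu>" using sets.sets_into_space[OF domain_sets] by blast
    then interpret prob_space "m x" by (rule prob_space_step)
    have "(\<integral>\<^sup>+y. torsion_iterate n y \<partial>m x) \<le> (\<integral>\<^sup>+y. of_nat n \<partial>m x)"
      by (intro nn_integral_mono Suc)
    also have "\<dots> = of_nat n" by (simp add: emeasure_space_1)
    finally show ?thesis using True by (simp add: add_left_mono)
  qed simp
qed simp

definition torsion_approx :: "nat \<Rightarrow> 'a \<Rightarrow> real" where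
  "torsion_approx n x = enn2real (torsion_iterate n x)"

lemma torsion_iterate_less_top: "torsion_iterate n x < top"
  using torsion_iterate_le[of n x] of_nat_less_top by (rule order.strict_trans1)

lemma ennreal_torsion_approx: "ennreal (torsion_approx n x) = torsion_iterate n x"
  unfolding torsion_approx_def using torsion_iterate_less_top by simp

lemma torsion_approx_measurable[measurable]: "torsion_approx n \<in> borel_measurable \<nu>"
  unfolding torsion_approx_def[abs_def] by simp

lemma torsion_approx_bounds: "0 \<le> torsion_approx n x" "torsion_approx n x \<le> real n"
proof -
  show "0 \<le> torsion_approx n x" by (simp add: torsion_approx_def)
  show "torsion_approx n x \<le> real n"
    using torsion_iterate_le[of n x] unfolding ennreal_torsion_approx[symmetric]
    by (simp add: ennreal_of_nat_eq_real_of_nat)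
qed

lemma torsion_approx_outside: "x \<notin> \<Omega> \<Longrightarrow> torsion_approx n x = 0"
  by (simp add: torsion_approx_def torsion_iterate_outside)

text \<open>Each iterate is a subsolution: monotonicity gives u_n <= u_(n+1) = 1 + (mean of u_n
  under \<open>m x\<close>) on \<Omega>, which is rearranged after passing to real values.\<close>

lemma laplacian_torsion_approx:
  assumes x: "x \<in> \<Omega>"
  shows "- 1 \<le> laplacian (torsion_approx n) x"
proof -
  have sp: "x \<in> space \<nu>" using x sets.sets_into_space[OF domain_sets] by blast
  interpret prob_space "m x" using sp by (rule prob_space_step)
  have [measurable]: "torsion_approx n \<in> borel_measurable (m x)"
    using sp by (simp add: borel_measurable_step)
  have int: "integrable (m x) (torsion_approx n)"
    by (rule integrable_const_bound[where B="real n"]) (use torsion_approx_bounds in auto)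
  have "ennreal (torsion_approx n x) \<le> torsion_iterate (Suc n) x"
    unfolding ennreal_torsion_approx by (rule torsion_iterate_mono)
  also have "\<dots> = 1 + (\<integral>\<^sup>+y. ennreal (torsion_approx n y) \<partial>m x)"
    using x by (simp add: ennreal_torsion_approx)
  also have "\<dots> = ennreal (1 + (\<integral>y. torsion_approx n y \<partial>m x))"
    using nn_integral_eq_integral[OF int] torsion_approx_bounds(1) by (simp add: ennreal_plus)
  finally have "torsion_approx n x \<le> 1 + (\<integral>y. torsion_approx n y \<partial>m x)"
    using torsion_approx_bounds(1)[of n] by (subst (asm) ennreal_le_iff) (simp_all del: ennreal_plus)
  moreover have "laplacian (torsion_approx n) x = (\<integral>y. torsion_approx n y \<partial>m x) - torsion_approx n x"
    unfolding laplacian_def using int by (simp add: prob_space)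
  ultimately show ?thesis by simp
qed

end

section \<open>Uniform L2 bound from the Poincare inequality\<close>

locale poincare_domain = walk_domain +
  assumes finite_domain: "emeasure \<nu> \<Omega> < \<infinity>"
    and poincare: "poincare2 m \<nu> \<Omega>"
begin

lemma torsion_approx_square_integrable: "square_integrable (torsion_approx n)"
proof -
  have "integrable \<nu> (\<lambda>x. indicator \<Omega> x * (real n)\<^sup>2)"
    using finite_domain by simp
  then have "integrable \<nu> (\<lambda>x. (torsion_approx n x)\<^sup>2)"
    by (rule Bochner_Integration.integrable_bound)
      (auto simp: indicator_def torsion_approx_bounds torsion_approx_outside intro!: AE_I2 power_mono)
  then show ?thesis by (simp add: square_integrable_def)
qed

text \<open>
  Testing the Poincare inequality with the iterates gives
  \<open>c \<integral>u\<^sup>2 \<le> 2 \<integral>u\<close>, and the right-hand side is absorbed by AM-GM.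
\<close>
lemma torsion_iterate_L2_bound:
  obtains C where "C < \<infinity>" "\<And>n. (\<integral>\<^sup>+x. (torsion_iterate n x)\<^sup>2 \<partial>\<nu>) \<le> C"
proof -
  obtain c where c: "0 < c" and P: "\<And>f. f \<in> L2_vanishing m \<nu> \<Omega> \<Longrightarrow>
      c * (LINT x:\<Omega>|\<nu>. \<bar>f x\<bar>\<^sup>2) \<le> grad_integral m \<nu> \<Omega> f"
    using poincare unfolding poincare2_def by blast
  have bound: "(\<integral>x. (torsion_approx n x)\<^sup>2 \<partial>\<nu>) \<le> 4 / c\<^sup>2 * measure \<nu> \<Omega>" for n
  proof -
    define u where "u = torsion_approx n"
    have u: "square_integrable u" unfolding u_def by (rule torsion_approx_square_integrable)
    have out: "u x = 0" if "x \<notin> \<Omega>" for x unfolding u_def using that by (rule torsion_approx_outside)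
    have nonneg: "0 \<le> u x" for x unfolding u_def by (rule torsion_approx_bounds)
    note su = square_integrableD(2)[OF u]
    have van: "u \<in> L2_vanishing m \<nu> \<Omega>" "cut u = u"
      using supported_in_L2_vanishing[OF u] out by blast+
    have ind: "integrable \<nu> (indicat_real \<Omega>)" using finite_domain by simp
    have "c * (\<integral>x. (u x)\<^sup>2 \<partial>\<nu>) = c * (LINT x:\<Omega>|\<nu>. \<bar>u x\<bar>\<^sup>2)"
      unfolding set_lebesgue_integral_def
      by (simp, intro disjI2 Bochner_Integration.integral_cong) (auto simp: indicator_def out)
    also have "\<dots> \<le> energy u u"
      using P[OF van(1)] grad_integral_eq_energy[OF van(1)] van(2) by simp
    also have "\<dots> = (\<integral>x. - 2 * (laplacian u x * u x) \<partial>\<nu>)"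
      by (simp add: green[OF u u])
    \<comment> \<open>The weight c/2 leaves half of the left-hand side after absorption. The
      remaining constant 2/c, from completing the square (c u - 2)^2 / (2 c), is carried by \<Omega>
      and so has finite integral.\<close>
    also have "\<dots> \<le> (\<integral>x. c / 2 * (u x)\<^sup>2 + 2 / c * indicator \<Omega> x \<partial>\<nu>)"
    proof (rule integral_mono)
      show "integrable \<nu> (\<lambda>x. - 2 * (laplacian u x * u x))"
        using laplacian_integrable[OF u u] by simp
      show "integrable \<nu> (\<lambda>x. c / 2 * (u x)\<^sup>2 + 2 / c * indicator \<Omega> x)"
        using su ind by simp
      fix x
      show "- 2 * (laplacian u x * u x) \<le> c / 2 * (u x)\<^sup>2 + 2 / c * indicator \<Omega> x"
      proof (cases "x \<in> \<Omega>")
        case True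
        have "- 1 \<le> laplacian u x" unfolding u_def using True by (rule laplacian_torsion_approx)
        then have "- 2 * (laplacian u x * u x) \<le> 2 * u x"
          using mult_right_mono[of "-1" "laplacian u x" "u x"] nonneg[of x] by linarith
        also have "2 * u x \<le> c / 2 * (u x)\<^sup>2 + 2 / c"
        proof -
          have "c / 2 * (u x)\<^sup>2 + 2 / c - 2 * u x = (c * u x - 2)\<^sup>2 / (2 * c)"
            using c by (simp add: field_simps power2_eq_square)
          also have "\<dots> \<ge> 0" using c by simp
          finally show ?thesis by simp
        qed
        finally show ?thesis using True by simp
      qed (simp add: out)
    qed
    also have "\<dots> = c / 2 * (\<integral>x. (u x)\<^sup>2 \<partial>\<nu>) + 2 / c * measure \<nu> \<Omega>"
      using su ind by simp
    finally have "c / 2 * (\<integral>x. (u x)\<^sup>2 \<partial>\<nu>) \<le> 2 / c * measure \<nu> \<Omega>" by simp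
    then have "2 / c * (c / 2 * (\<integral>x. (u x)\<^sup>2 \<partial>\<nu>)) \<le> 2 / c * (2 / c * measure \<nu> \<Omega>)"
      using c by (intro mult_left_mono) simp_all
    then have "(\<integral>x. (u x)\<^sup>2 \<partial>\<nu>) \<le> 4 / c\<^sup>2 * measure \<nu> \<Omega>"
      using c by (simp add: power2_eq_square)
    then show ?thesis by (simp add: u_def)
  qed
  show ?thesis
  proof
    show "ennreal (4 / c\<^sup>2 * measure \<nu> \<Omega>) < \<infinity>" by simp
    fix n
    have "(\<integral>\<^sup>+x. (torsion_iterate n x)\<^sup>2 \<partial>\<nu>) = (\<integral>\<^sup>+x. ennreal ((torsion_approx n x)\<^sup>2) \<partial>\<nu>)"
      by (simp add: ennreal_torsion_approx[symmetric] ennreal_power torsion_approx_bounds)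
    also have "\<dots> = ennreal (\<integral>x. (torsion_approx n x)\<^sup>2 \<partial>\<nu>)"
      by (rule nn_integral_eq_integral)
        (simp_all add: square_integrableD[OF torsion_approx_square_integrable])
    also have "\<dots> \<le> ennreal (4 / c\<^sup>2 * measure \<nu> \<Omega>)" using bound by (rule ennreal_leI)
    finally show "(\<integral>\<^sup>+x. (torsion_iterate n x)\<^sup>2 \<partial>\<nu>) \<le> ennreal (4 / c\<^sup>2 * measure \<nu> \<Omega>)" .
  qed
qed

section \<open>Passage to the limit and existence of the stress function\<close>

definition torsion_limit :: "'a \<Rightarrow> ennreal" where
  "torsion_limit x = (SUP n. torsion_iterate n x)"

lemma torsion_limit_measurable[measurable]: "torsion_limit \<in> borel_measurable \<nu>"
  unfolding torsion_limit_def[abs_def] by simp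

lemma torsion_limit_outside: "x \<notin> \<Omega> \<Longrightarrow> torsion_limit x = 0"
  by (simp add: torsion_limit_def torsion_iterate_outside)

text \<open>Monotone convergence lets the supremum pass through the integral. Working in
  \<open>ennreal\<close>, the equation holds at every point of \<Omega>, before finiteness of the
  limit is known.\<close>

lemma torsion_limit_fixpoint:
  assumes x: "x \<in> \<Omega>"
  shows "torsion_limit x = 1 + (\<integral>\<^sup>+y. torsion_limit y \<partial>m x)"
proof -
  have sp: "x \<in> space \<nu>" using x sets.sets_into_space[OF domain_sets] by blast
  have "1 + (\<integral>\<^sup>+y. torsion_limit y \<partial>m x) = 1 + (SUP n. \<integral>\<^sup>+y. torsion_iterate n y \<partial>m x)"
    unfolding torsion_limit_def
    by (subst nn_integral_monotone_convergence_SUP[OF incseq_torsion_iterate])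
      (simp_all add: borel_measurable_step sp)
  also have "\<dots> = (SUP n. torsion_iterate (Suc n) x)"
    using x by (simp add: ennreal_SUP_add_right)
  \<comment> \<open>Dropping the first term of an increasing sequence keeps its supremum.\<close>
  also have "\<dots> = torsion_limit x"
    unfolding torsion_limit_def
    by (intro antisym SUP_mono) (use torsion_iterate_mono in blast)+
  finally show ?thesis by simp
qed

lemma torsion_limit_L2: "(\<integral>\<^sup>+x. (torsion_limit x)\<^sup>2 \<partial>\<nu>) < \<infinity>"
proof -
  obtain C where C: "C < \<infinity>" "\<And>n. (\<integral>\<^sup>+x. (torsion_iterate n x)\<^sup>2 \<partial>\<nu>) \<le> C"
    using torsion_iterate_L2_bound by blast
  have mono: "torsion_iterate i x \<le> torsion_iterate j x" if "i \<le> j" for i j x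
    using incseqD[OF incseq_torsion_iterate that] by (rule le_funD)
  \<comment> \<open>The square of the supremum is a double supremum over i and j, dominated by the
    diagonal term at \<open>max i j\<close>.\<close>
  have "(torsion_limit x)\<^sup>2 \<le> (SUP n. (torsion_iterate n x)\<^sup>2)" for x
    unfolding torsion_limit_def power2_eq_square SUP_mult_right_ennreal SUP_mult_left_ennreal
  proof (intro SUP_least)
    fix i j
    show "torsion_iterate i x * torsion_iterate j x
        \<le> (SUP n. torsion_iterate n x * torsion_iterate n x)"
      by (rule SUP_upper2[of "max i j"]) (auto intro!: mult_mono mono)
  qed
  then have "(\<integral>\<^sup>+x. (torsion_limit x)\<^sup>2 \<partial>\<nu>) \<le> (\<integral>\<^sup>+x. (SUP n. (torsion_iterate n x)\<^sup>2) \<partial>\<nu>)"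
    by (intro nn_integral_mono) simp
  also have "\<dots> = (SUP n. \<integral>\<^sup>+x. (torsion_iterate n x)\<^sup>2 \<partial>\<nu>)"
    by (rule nn_integral_monotone_convergence_SUP)
      (auto intro!: incseq_SucI le_funI power_mono torsion_iterate_mono simp del: torsion_iterate.simps)
  also have "\<dots> \<le> C" using C(2) by (rule SUP_least)
  finally show ?thesis using C(1) by simp
qed

text \<open>The L2 bound makes the limit finite almost everywhere, so its real-valued version
  inherits the fixed-point equation, which is the stress equation.\<close>

lemma ex_stress_function: "\<exists>f. is_stress_function m \<nu> \<Omega> f"
proof -
  define f where "f x = enn2real (torsion_limit x)" for x
  have [measurable]: "f \<in> borel_measurable \<nu>" unfolding f_def by measurable
  have out: "f x = 0" if "x \<notin> \<Omega>" for x using that by (simp add: f_def torsion_limit_outside)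
  have "AE x in \<nu>. (torsion_limit x)\<^sup>2 \<noteq> \<infinity>"
    using torsion_limit_L2 by (intro nn_integral_PInf_AE) auto
  then have fin: "AE x in \<nu>. torsion_limit x < \<infinity>"
    by eventually_elim (auto simp: less_top[symmetric] power2_eq_square)
  have "(\<integral>\<^sup>+x. ennreal ((f x)\<^sup>2) \<partial>\<nu>) = (\<integral>\<^sup>+x. (torsion_limit x)\<^sup>2 \<partial>\<nu>)"
  proof (rule nn_integral_cong_AE)
    show "AE x in \<nu>. ennreal ((f x)\<^sup>2) = (torsion_limit x)\<^sup>2"
      using fin by eventually_elim (simp add: f_def ennreal_power[symmetric])
  qed
  then have "integrable \<nu> (\<lambda>x. (f x)\<^sup>2)"
    using torsion_limit_L2 by (intro integrableI_nonneg) auto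
  then have "square_integrable f" by (simp add: square_integrable_def)
  from supported_in_L2_vanishing[OF this]
  have van: "f \<in> L2_vanishing m \<nu> \<Omega>" "cut f = f" using out by blast+
  have "AE x in \<nu>. x \<in> \<Omega> \<longrightarrow> laplacian f x = -1"
    \<comment> \<open>Invariance of \<nu> is what makes the limit finite \<open>m x\<close>-almost
      everywhere for almost every x.\<close>
    using AE_edge_measureD[OF AE_edge_snd[OF fin]] fin AE_space
  proof eventually_elim
    case (elim x)
    interpret prob_space "m x" using elim(3) by (rule prob_space_step)
    have [measurable]: "f \<in> borel_measurable (m x)"
      using elim(3) by (simp add: borel_measurable_step)
    show ?case
    proof
      assume x: "x \<in> \<Omega>"
      have eq: "(\<integral>\<^sup>+y. ennreal (f y) \<partial>m x) = (\<integral>\<^sup>+y. torsion_limit y \<partial>m x)"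
      proof (rule nn_integral_cong_AE)
        show "AE y in m x. ennreal (f y) = torsion_limit y"
          using elim(1) by eventually_elim (simp add: f_def)
      qed
      have step: "torsion_limit x = 1 + (\<integral>\<^sup>+y. ennreal (f y) \<partial>m x)"
        using torsion_limit_fixpoint[OF x] by (simp add: eq)
      \<comment> \<open>Finiteness of the limit at x itself bounds the integral, so \<open>f\<close>
        is integrable for \<open>m x\<close>.\<close>
      then have "(\<integral>\<^sup>+y. ennreal (f y) \<partial>m x) < \<infinity>" using elim(2) by auto
      then have int: "integrable (m x) f"
        by (intro integrableI_nonneg) (auto simp: f_def)
      have "torsion_limit x = ennreal (1 + (\<integral>y. f y \<partial>m x))"
        unfolding step by (subst nn_integral_eq_integral[OF int]) (simp_all add: f_def)
      moreover have "0 \<le> (\<integral>y. f y \<partial>m x)" by (simp add: f_def)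
      ultimately have "f x = 1 + (\<integral>y. f y \<partial>m x)"
        unfolding f_def[of x] by (simp del: ennreal_plus)
      then show "laplacian f x = -1"
        unfolding laplacian_def using int by (simp add: prob_space)
    qed
  qed
  with AE_laplacian_cut[OF van(1)]
  have "AE x in \<nu>. x \<in> \<Omega> \<longrightarrow> - (LINT y:\<Omega>\<^sub>m|m x. (f y - f x)) = 1"
    by eventually_elim (simp add: van(2))
  then have "is_stress_function m \<nu> \<Omega> f"
    using van(1) by (simp add: is_stress_function_def L2_vanishing_def)
  then show ?thesis by blast
qed

section \<open>Variational characterisation of the torsional rigidity\<close>

lemma is_stress_function_stress_function: "is_stress_function m \<nu> \<Omega> (stress_function m \<nu> \<Omega>)"
  unfolding stress_function_def using ex_stress_function by (rule someI_ex)

lemma stress_function_energy: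
  "energy (cut (stress_function m \<nu> \<Omega>)) (cut (stress_function m \<nu> \<Omega>)) = 2 * torsional_rigidity m \<nu> \<Omega>"
  unfolding torsional_rigidity_def
  using is_stress_function_stress_function
  by (intro energy_stress_function stress_function_imp_L2_vanishing)

text \<open>The weak equation identifies the mixed energy with 2 I and the energy of the stress
  function with 2 T, so Cauchy-Schwarz reads (2 I)^2 <= 2 T E.\<close>

lemma torsion_quotient_le:
  assumes g: "g \<in> L2_vanishing m \<nu> \<Omega>"
  shows "torsion_quotient m \<nu> \<Omega> g \<le> torsional_rigidity m \<nu> \<Omega>"
proof -
  define f where "f = stress_function m \<nu> \<Omega>"
  define T I E where "T = torsional_rigidity m \<nu> \<Omega>" and "I = (LINT x:\<Omega>|\<nu>. g x)"
    and "E = energy (cut g) (cut g)"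
  have f: "is_stress_function m \<nu> \<Omega> f"
    unfolding f_def by (rule is_stress_function_stress_function)
  have ff: "energy (cut f) (cut f) = 2 * T"
    unfolding f_def T_def by (rule stress_function_energy)
  then have "0 \<le> T" using energy_nonneg[of "cut f"] by simp
  have "(2 * I)\<^sup>2 \<le> 2 * T * E"
    using energy_Cauchy_Schwarz[OF cut_square_integrable[OF stress_function_imp_L2_vanishing[OF f]]
        cut_square_integrable[OF g]]
    unfolding energy_stress_function[OF f g] ff E_def I_def .
  then have "I\<^sup>2 \<le> T * (1 / 2 * E)" by (simp add: power2_eq_square mult_ac)
  moreover have "0 \<le> E" unfolding E_def by (rule energy_nonneg)
  \<comment> \<open>If E = 0, the quotient is 0 by the convention for division, and T is nonnegative
    as half an energy.\<close>
  ultimately have "I\<^sup>2 / (1 / 2 * E) \<le> T"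
    using \<open>0 \<le> T\<close> by (cases "E = 0") (simp_all add: divide_le_eq)
  then show ?thesis
    unfolding torsion_quotient_def grad_integral_eq_energy[OF g] T_def I_def E_def .
qed

lemma torsion_quotient_stress_function:
  "torsion_quotient m \<nu> \<Omega> (stress_function m \<nu> \<Omega>) = torsional_rigidity m \<nu> \<Omega>"
proof -
  note van = stress_function_imp_L2_vanishing[OF is_stress_function_stress_function]
  show ?thesis
    unfolding torsion_quotient_def grad_integral_eq_energy[OF van] stress_function_energy
    by (simp add: torsional_rigidity_def[symmetric] power2_eq_square)
qed

text \<open>If the stress function vanished almost everywhere, so would its Laplacian, which equals
  -1 almost everywhere on a set of positive measure.\<close>

lemma stress_function_admissible:
  assumes "0 < emeasure \<nu> \<Omega>"
  shows "stress_function m \<nu> \<Omega> \<in> torsion_admissible m \<nu> \<Omega>"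
proof -
  define f where "f = stress_function m \<nu> \<Omega>"
  have f: "is_stress_function m \<nu> \<Omega> f"
    unfolding f_def by (rule is_stress_function_stress_function)
  note van = stress_function_imp_L2_vanishing[OF f]
  have "\<not> (AE x in \<nu>. x \<in> \<Omega>\<^sub>m \<longrightarrow> f x = 0)"
  proof
    assume "AE x in \<nu>. x \<in> \<Omega>\<^sub>m \<longrightarrow> f x = 0"
    then have zero: "AE x in \<nu>. cut f x = 0"
      by eventually_elim (auto simp: cut_def m_closure_def indicator_def)
    have "AE x in \<nu>. x \<notin> \<Omega>"
      using AE_edge_measureD[OF AE_edge_snd[OF zero]] zero AE_laplacian_stress_function[OF f]
    proof eventually_elim
      case (elim x)
      then have "laplacian (cut f) x = 0"
        unfolding laplacian_def by (intro integral_eq_zero_AE) simp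
      then show ?case using elim(3) by auto
    qed
    then have "\<Omega> \<in> null_sets \<nu>"
      using AE_iff_null_sets[OF domain_sets] by blast
    then show False using assms by auto
  qed
  then show ?thesis using van by (simp add: torsion_admissible_def f_def)
qed

end

theorem theorem3p3:
  fixes m :: "'a \<Rightarrow> 'a measure" and \<nu> :: "'a measure" and \<Omega> :: "'a set"
  assumes "reversible_random_walk_space m \<nu>"
    and "\<Omega> \<in> sets \<nu>"
    and "m_connected m \<nu> \<Omega>"
    and "0 < emeasure \<nu> \<Omega>"
    and "emeasure \<nu> \<Omega> < emeasure \<nu> (m_closure m \<nu> \<Omega>)"
    and "emeasure \<nu> (m_closure m \<nu> \<Omega>) < \<infinity>"
    and "poincare2 m \<nu> \<Omega>"
  shows "torsional_rigidity m \<nu> \<Omega> \<in> torsion_quotient m \<nu> \<Omega> ` torsion_admissible m \<nu> \<Omega> \<and>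
    (\<forall>q \<in> torsion_quotient m \<nu> \<Omega> ` torsion_admissible m \<nu> \<Omega>. q \<le> torsional_rigidity m \<nu> \<Omega>) \<and>
    stress_function m \<nu> \<Omega> \<in> torsion_admissible m \<nu> \<Omega> \<and>
    torsion_quotient m \<nu> \<Omega> (stress_function m \<nu> \<Omega>) = torsional_rigidity m \<nu> \<Omega>"
proof -
  interpret poincare_domain m \<nu> \<Omega>
  proof
    show "space \<nu> \<noteq> {}"
      using assms(2,4) sets.sets_into_space[of \<Omega> \<nu>] by auto
    show "emeasure \<nu> \<Omega> < \<infinity>"
      using assms(5,6) by (rule order.strict_trans)
  qed (use assms in auto)
  note adm = stress_function_admissible[OF assms(4)]
  have "torsion_quotient m \<nu> \<Omega> g \<le> torsional_rigidity m \<nu> \<Omega>"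
    if "g \<in> torsion_admissible m \<nu> \<Omega>" for g
    using that by (intro torsion_quotient_le) (simp add: torsion_admissible_def)
  then show ?thesis
    using adm torsion_quotient_stress_function by (auto intro: image_eqI[OF _ adm])
qed

end
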